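(* Let $H=\langle m_0,\dots,m_p,n\rangle$ be a numerical semigroup minimally generated by an almost arithmetic sequence, with associated data as in the context, and assume $W\ne\emptyset$. Suppose $r'=1$, $\mu>0$ and $q'=0$. Then $\mathrm{PF}_1(H)=\{\alpha_p\}$ and there exists an $\mathrm{RF}$-matrix for $\alpha_p$ whose rows (indexed by $0,1,\dots,p,n$) are: row $0$: $-E_0+(v-1)E_n$; row $j$ for $j\in[1,p]$: $(\nu-2)E_0+E_{j-1}-E_j+(w-1)E_n$ (so row $1$ is $(\nu-1)E_0-E_1+(w-1)E_n$); row $n$: $(\mu-1)E_0+q_zE_p-E_n+E_{r_z}$.
   Context: Notation: $\mathbb N=\{0,1,2,\dots\}$; $[a,b]$ is the set of integers $i$ with $a\le i\le b$. Let $p\ge1$, $d\ge1$, $m_0\ge 1$ be integers, $m_i=m_0+id$ for $i\in[0,p]$, and $n\ge1$ an integer with $\gcd(m_0,d,n)=1$. Put $H'=\sum_{i=0}^p\mathbb Nm_i$ and $H=H'+\mathbb Nn=\langle m_0,\dots,m_p,n\rangle$; assume $\{m_0,\dots,m_p,n\}$ is a minimal generating set of $H$. $\mathrm{Ap}(H,m_0)=\{h\in H: h-m_0\notin H\}$. For $t\in\mathbb N$ write $t=q_tp+r_t$ with $q_t\in\mathbb Z$, $r_t\in[1,p]$, and set $g_t=q_tm_p+m_{r_t}$ (so $q_0=-1$, $r_0=p$, $g_0=0$). Let $u=\min\{t\in\mathbb N: g_t\notin\mathrm{Ap}(H,m_0)\}$ and $v=\min\{b\ge1: bn\in H'\}$.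 It is known (Patil–Singh) that there are unique integers $z\in[0,u-1]$, $w\in[0,v-1]$, $\lambda\ge1$, $\mu\ge0$ with $g_u=\lambda m_0+wn$, $vn=\mu m_0+g_z$, and $g_{u-z}+(v-w)n=\nu m_0$, where $\nu=\lambda+\mu+1$ if $r_{u-z}<r_u$ and $\nu=\lambda+\mu$ if $r_{u-z}\ge r_u$. Set $r=r_u$, $q=q_u$, $r'=r_{u-z}$, $q'=q_{u-z}$, and $W=[u-z,u-1]\times[v-w,v-1]$ (empty iff $z=0$ or $w=0$). $\mathrm{PF}(H)$ is the set of $f\in\mathbb Z\setminus H$ with $f+h\in H$ for all $h\in H\setminus\{0\}$. An $\mathrm{RF}$-matrix for $f\in\mathrm{PF}(H)$ is a $(p+2)\times(p+2)$ integer matrix with rows and columns indexed by $0,1,\dots,p,n$ (corresponding to the generators $m_0,\dots,m_p,n$), with all diagonal entries $-1$, all off-diagonal entries in $\mathbb N$, and such that each row $(b_0,\dots,b_p,b_n)$ satisfies $\sum_{j=0}^p b_jm_j+b_nn=f$. $E_0,\dots,E_p,E_n$ denote the standard basis vectors of $\mathbb Z^{p+2}$ (coordinates indexed by $0,\dots,p,n$). When $W\neq\emptyset$, let $\alpha_i=g_{(q'-1)p+i}+(v-1)n-m_0$ for $i\in I$, where $I=\{p\}$ if $r'=1,q'=0$; $I=[1,p]$ if $r'=1,q'>0$; $I=[p+1,p+r'-1]$ if $r'\ge2$. $\mathrm{PF}_1(H)$ denotes the set of pseudo-Frobenius numbers of $H$ of the form $\alpha_i$, $i\in I$. *)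

theory Defs
  imports "Jordan_Normal_Form.Matrix"
begin

text \<open>Throughout, \<open>p\<close>, \<open>d\<close>, \<open>m0\<close>, \<open>n\<close> are the parameters of the almost arithmetic sequence
  \<open>m\<^sub>0, \<dots>, m\<^sub>p, n\<close> with \<open>m\<^sub>i = m\<^sub>0 + i d\<close>. Semigroups are sets of integers, so that differences
  such as \<open>h - m\<^sub>0\<close> are not truncated.\<close>

definition nat_span :: "int set \<Rightarrow> int set" where
  \<comment> \<open>the monoid generated by \<open>A\<close>; only meaningful for finite \<open>A\<close>\<close>
  "nat_span A = {\<Sum>a\<in>A. int (c a) * a | c :: int \<Rightarrow> nat. True}"

definition minimal_generating_set :: "int set \<Rightarrow> int set \<Rightarrow> bool" where
  "minimal_generating_set A S \<longleftrightarrow> finite A \<and> nat_span A = S \<and> (\<forall>B. B \<subset> A \<longrightarrow> nat_span B \<noteq> S)"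

definition m_seq :: "int \<Rightarrow> int \<Rightarrow> int \<Rightarrow> int" where
  "m_seq d m0 i = m0 + i * d"

definition Hprime :: "nat \<Rightarrow> int \<Rightarrow> int \<Rightarrow> int set" where
  "Hprime p d m0 = {\<Sum>i = 0..p. int (c i) * m_seq d m0 (int i) | c :: nat \<Rightarrow> nat. True}"

definition H :: "nat \<Rightarrow> int \<Rightarrow> int \<Rightarrow> int \<Rightarrow> int set" where
  "H p d m0 n = {h + int b * n | h b. h \<in> Hprime p d m0}"

definition Ap :: "int set \<Rightarrow> int \<Rightarrow> int set" where
  "Ap S m = {h \<in> S. h - m \<notin> S}"

definition PF :: "int set \<Rightarrow> int set" where
  "PF S = {f. f \<notin> S \<and> (\<forall>h \<in> S - {0}. f + h \<in> S)}"

text \<open>Division with remainder in \<open>[1, p]\<close> instead of \<open>[0, p - 1]\<close>.\<close>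

definition q_of :: "nat \<Rightarrow> int \<Rightarrow> int" where
  "q_of p t = (t - 1) div int p"

definition r_of :: "nat \<Rightarrow> int \<Rightarrow> int" where
  "r_of p t = (t - 1) mod int p + 1"

lemma q_of_r_of_iff:
  assumes "p \<ge> 1"
  shows "t = a * int p + b \<and> b \<in> {1..int p} \<longleftrightarrow> a = q_of p t \<and> b = r_of p t"
proof
  assume *: "t = a * int p + b \<and> b \<in> {1..int p}"
  then have "t - 1 = int p * a + (b - 1)" "0 \<le> b - 1" "b - 1 < int p"
    by (auto simp: algebra_simps)
  then have "(t - 1) div int p = a" "(t - 1) mod int p = b - 1"
    by (rule int_div_pos_eq, rule int_mod_pos_eq)
  then show "a = q_of p t \<and> b = r_of p t"
    unfolding q_of_def r_of_def by simp
next
  assume *: "a = q_of p t \<and> b = r_of p t"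
  have "(t - 1) div int p * int p + (t - 1) mod int p = t - 1"
    by (rule div_mult_mod_eq)
  moreover have "0 \<le> (t - 1) mod int p" "(t - 1) mod int p < int p"
    using assms by auto
  ultimately show "t = a * int p + b \<and> b \<in> {1..int p}"
    using * unfolding q_of_def r_of_def by auto
qed

definition g_of :: "nat \<Rightarrow> int \<Rightarrow> int \<Rightarrow> int \<Rightarrow> int" where
  "g_of p d m0 t = q_of p t * m_seq d m0 (int p) + m_seq d m0 (r_of p t)"

definition u_of :: "nat \<Rightarrow> int \<Rightarrow> int \<Rightarrow> int \<Rightarrow> int" where
  "u_of p d m0 n = int (LEAST t :: nat. g_of p d m0 (int t) \<notin> Ap (H p d m0 n) m0)"

definition v_of :: "nat \<Rightarrow> int \<Rightarrow> int \<Rightarrow> int \<Rightarrow> int" where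
  "v_of p d m0 n = int (LEAST b :: nat. b \<ge> 1 \<and> int b * n \<in> Hprime p d m0)"

text \<open>In the following, \<open>q'\<close> and \<open>r'\<close> stand for \<open>q\<close> and \<open>r\<close> at \<open>u - z\<close>.
  Since \<open>u - z \<ge> 1\<close>, always \<open>r' \<ge> 1\<close> and \<open>q' \<ge> 0\<close>.\<close>

definition alpha :: "nat \<Rightarrow> int \<Rightarrow> int \<Rightarrow> int \<Rightarrow> int \<Rightarrow> int \<Rightarrow> int \<Rightarrow> int" where
  "alpha p d m0 n v q' i = g_of p d m0 ((q' - 1) * int p + i) + (v - 1) * n - m0"

definition alpha_index :: "nat \<Rightarrow> int \<Rightarrow> int \<Rightarrow> int set" where
  "alpha_index p q' r' =
    (if r' = 1 then (if q' = 0 then {int p} else {1..int p})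
     else {int p + 1..int p + r' - 1})"

definition PF1 :: "nat \<Rightarrow> int \<Rightarrow> int \<Rightarrow> int \<Rightarrow> int \<Rightarrow> int \<Rightarrow> int \<Rightarrow> int set" where
  "PF1 p d m0 n v q' r' = PF (H p d m0 n) \<inter> alpha p d m0 n v q' ` alpha_index p q' r'"

text \<open>Rows, columns and coordinates labelled \<open>0, \<dots>, p, n\<close> are numbered \<open>0, \<dots>, p, p + 1\<close>.\<close>

definition generator :: "nat \<Rightarrow> int \<Rightarrow> int \<Rightarrow> int \<Rightarrow> nat \<Rightarrow> int" where
  "generator p d m0 n j = (if j \<le> p then m_seq d m0 (int j) else n)"

definition RF_matrix :: "nat \<Rightarrow> int \<Rightarrow> int \<Rightarrow> int \<Rightarrow> int \<Rightarrow> int mat \<Rightarrow> bool" where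
  "RF_matrix p d m0 n f A \<longleftrightarrow>
    f \<in> PF (H p d m0 n) \<and>
    A \<in> carrier_mat (p + 2) (p + 2) \<and>
    (\<forall>i < p + 2. A $$ (i, i) = -1) \<and>
    (\<forall>i < p + 2. \<forall>j < p + 2. i \<noteq> j \<longrightarrow> A $$ (i, j) \<ge> 0) \<and>
    (\<forall>i < p + 2. (\<Sum>j < p + 2. A $$ (i, j) * generator p d m0 n j) = f)"

abbreviation E :: "nat \<Rightarrow> nat \<Rightarrow> int vec" where
  "E p j \<equiv> unit_vec (p + 2) j"

end

theory Submission
  imports Defs
begin

text \<open>The hypotheses \<open>r' = 1\<close> and \<open>q' = 0\<close> force \<open>u - z = 1\<close>, so \<open>\<alpha>\<^sub>p = (v - 1) n - m\<^sub>0\<close>, and the two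
  relations \<open>m\<^sub>1 + (v - w) n = \<nu> m\<^sub>0\<close> and \<open>v n = \<mu> m\<^sub>0 + g\<^sub>z\<close> turn into the required rows.
  Such rows give \<open>\<alpha>\<^sub>p + h \<in> H\<close> for all nonzero \<open>h \<in> H\<close>: add the coefficients of \<open>h\<close> to the row of
  a generator that occurs in \<open>h\<close>, which cancels the only negative entry.
  Finally \<open>\<alpha>\<^sub>p \<notin> H\<close> because \<open>v\<close> is the least positive multiplier that brings \<open>n\<close> into \<open>H'\<close>.\<close>

lemma sum_generator_split:
  "(\<Sum>j<p + 2. a j * generator p d m0 n j)
    = (\<Sum>j = 0..p. a j * m_seq d m0 (int j)) + a (p + 1) * n"
proof -
  have "(\<Sum>j<p + 2. a j * generator p d m0 n j)
      = (\<Sum>j<Suc p. a j * generator p d m0 n j) + a (p + 1) * n"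
    by (simp add: generator_def)
  also have "(\<Sum>j<Suc p. a j * generator p d m0 n j) = (\<Sum>j = 0..p. a j * m_seq d m0 (int j))"
    by (intro sum.cong) (auto simp: generator_def)
  finally show ?thesis .
qed

text \<open>Puts membership in the form used by the rows of an RF-matrix: a coefficient vector over
  all \<open>p + 2\<close> generators. The rows and the elements of \<open>H\<close> can then be
  added entrywise.\<close>

lemma mem_H_iff:
  "h \<in> H p d m0 n \<longleftrightarrow>
    (\<exists>a. (\<forall>j < p + 2. a j \<ge> 0) \<and> h = (\<Sum>j<p + 2. a j * generator p d m0 n j))"
proof
  assume "h \<in> H p d m0 n"
  then obtain c b where "h = (\<Sum>i = 0..p. int (c i) * m_seq d m0 (int i)) + int b * n"
    unfolding H_def Hprime_def by auto
  \<comment> \<open>Index \<open>p + 1\<close> belongs to \<open>n\<close>, so the update stores the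
    coefficient \<open>b\<close> there and leaves those of \<open>m_0, ..., m_p\<close>
    unchanged.\<close>
  then have "h = (\<Sum>j<p + 2. int ((c(p + 1 := b)) j) * generator p d m0 n j)"
    unfolding sum_generator_split by (auto intro!: sum.cong)
  then show "\<exists>a. (\<forall>j < p + 2. a j \<ge> 0) \<and> h = (\<Sum>j<p + 2. a j * generator p d m0 n j)"
    by (intro exI[of _ "\<lambda>j. int ((c(p + 1 := b)) j)"]) auto
next
  assume "\<exists>a. (\<forall>j < p + 2. a j \<ge> 0) \<and> h = (\<Sum>j<p + 2. a j * generator p d m0 n j)"
  then obtain a where a: "\<forall>j < p + 2. a j \<ge> 0" "h = (\<Sum>j<p + 2. a j * generator p d m0 n j)"
    by auto
  have "h = (\<Sum>i = 0..p. int (nat (a i)) * m_seq d m0 (int i)) + int (nat (a (p + 1))) * n"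
    using a unfolding sum_generator_split by (auto intro!: sum.cong)
  then show "h \<in> H p d m0 n"
    unfolding H_def Hprime_def mem_Collect_eq
    by (intro exI[of _ "\<Sum>i = 0..p. int (nat (a i)) * m_seq d m0 (int i)"]
        exI[of _ "nat (a (p + 1))"] exI[of _ "\<lambda>i. nat (a i)"] conjI TrueI refl)
qed

lemma PF_if_RF_rows:
  assumes "f \<notin> H p d m0 n"
    and diag: "\<And>i. i < p + 2 \<Longrightarrow> A $$ (i, i) = -1"
    and off: "\<And>i j. i < p + 2 \<Longrightarrow> j < p + 2 \<Longrightarrow> i \<noteq> j \<Longrightarrow> A $$ (i, j) \<ge> 0"
    and rows: "\<And>i. i < p + 2 \<Longrightarrow> (\<Sum>j<p + 2. A $$ (i, j) * generator p d m0 n j) = f"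
  shows "f \<in> PF (H p d m0 n)"
  unfolding PF_def
proof (intro CollectI conjI ballI)
  fix h assume "h \<in> H p d m0 n - {0}"
  then obtain a where a: "\<forall>j < p + 2. a j \<ge> 0"
    and h: "h = (\<Sum>j<p + 2. a j * generator p d m0 n j)" and "h \<noteq> 0"
    by (auto simp: mem_H_iff)
  then obtain i where i: "i < p + 2" "a i \<noteq> 0"
    by (metis (no_types, lifting) lessThan_iff mult_zero_left sum.neutral)
  with a have "a i \<ge> 1"
    by (metis int_one_le_iff_zero_less order_le_less)
  then have "\<forall>j < p + 2. A $$ (i, j) + a j \<ge> 0"
    using a diag[OF i(1)] off[OF i(1)] by (metis add.commute add_nonneg_nonneg diff_ge_0_iff_ge
        uminus_add_conv_diff)
  moreover have "f + h = (\<Sum>j<p + 2. (A $$ (i, j) + a j) * generator p d m0 n j)"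
    unfolding h rows[OF i(1), symmetric] by (simp only: sum.distrib distrib_right)
  ultimately show "f + h \<in> H p d m0 n"
    unfolding mem_H_iff by (intro exI[of _ "\<lambda>j. A $$ (i, j) + a j"]) simp
qed (fact assms(1))

lemma Hprime_nonneg:
  assumes "d \<ge> 0" "m0 \<ge> 0" "h \<in> Hprime p d m0"
  shows "h \<ge> 0"
  using assms by (auto simp: Hprime_def m_seq_def intro!: sum_nonneg)

lemma Hprime_add_m0:
  assumes "h \<in> Hprime p d m0"
  shows "h + m0 \<in> Hprime p d m0"
proof -
  obtain c where c: "h = (\<Sum>i = 0..p. int (c i) * m_seq d m0 (int i))"
    using assms by (auto simp: Hprime_def)
  have "h + m0 = (\<Sum>i = 0..p. int ((c(0 := c 0 + 1)) i) * m_seq d m0 (int i))"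
    unfolding c sum.atLeast_Suc_atMost[OF le0] by (simp add: m_seq_def algebra_simps)
  then show ?thesis
    unfolding Hprime_def by blast
qed

text \<open>If the number were \<open>h + b n\<close> with \<open>h\<close> in \<open>H'\<close>,
  then \<open>(v - 1 - b) n = h + m0\<close> would again lie in \<open>H'\<close>. It is positive,
  so \<open>v - 1 - b\<close> would be a positive multiplier smaller than \<open>v\<close>.\<close>

lemma minimal_multiple_not_in_H:
  assumes "d \<ge> 0" "m0 \<ge> 1" "n \<ge> 0"
  shows "(v_of p d m0 n - 1) * n - m0 \<notin> H p d m0 n"
proof
  assume "(v_of p d m0 n - 1) * n - m0 \<in> H p d m0 n"
  then obtain h b where h: "h \<in> Hprime p d m0"
    and eq: "(v_of p d m0 n - 1) * n - m0 = h + int b * n"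
    unfolding H_def by auto
  define k where "k = v_of p d m0 n - 1 - int b"
  have kn: "k * n = h + m0"
    using eq by (simp add: k_def algebra_simps)
  have "h \<ge> 0"
    using Hprime_nonneg[OF _ _ h] assms by simp
  then have "k * n > 0"
    using kn assms by simp
  then have "k > 0"
    using assms(3) by (simp add: zero_less_mult_iff)
  moreover have "int (nat k) * n \<in> Hprime p d m0"
    using Hprime_add_m0[OF h] kn \<open>k > 0\<close> by simp
  moreover have "nat k < (LEAST b :: nat. b \<ge> 1 \<and> int b * n \<in> Hprime p d m0)"
    using \<open>k > 0\<close> unfolding k_def v_of_def by linarith
  ultimately show False
    using not_less_Least by fastforce
qed

theorem proposition4p1:
  fixes p :: nat and d m0 n u v z w lam mu nu q' r' :: int
  assumes "p \<ge> 1" and "d \<ge> 1" and "m0 \<ge> 1" and "n \<ge> 1"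
    and "gcd m0 (gcd d n) = 1"
    and "minimal_generating_set (insert n ((\<lambda>i. m_seq d m0 (int i)) ` {0..p})) (H p d m0 n)"
    and "u = u_of p d m0 n" and "v = v_of p d m0 n"
    and "z \<in> {0..u - 1}" and "w \<in> {0..v - 1}" and "lam \<ge> 1" and "mu \<ge> 0"
    and "g_of p d m0 u = lam * m0 + w * n"
    and "v * n = mu * m0 + g_of p d m0 z"
    and "g_of p d m0 (u - z) + (v - w) * n = nu * m0"
    and "nu = (if r_of p (u - z) < r_of p u then lam + mu + 1 else lam + mu)"
    and "q' = q_of p (u - z)" and "r' = r_of p (u - z)"
    and "{u - z..u - 1} \<times> {v - w..v - 1} \<noteq> {}"
    and "r' = 1" and "mu > 0" and "q' = 0"
  shows "PF1 p d m0 n v q' r' = {alpha p d m0 n v q' (int p)} \<and>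
    (\<exists>A. RF_matrix p d m0 n (alpha p d m0 n v q' (int p)) A \<and>
      row A 0 = - E p 0 + (v - 1) \<cdot>\<^sub>v E p (p + 1) \<and>
      (\<forall>j \<in> {1..p}. row A j =
        (nu - 2) \<cdot>\<^sub>v E p 0 + E p (j - 1) - E p j + (w - 1) \<cdot>\<^sub>v E p (p + 1)) \<and>
      row A 1 = (nu - 1) \<cdot>\<^sub>v E p 0 - E p 1 + (w - 1) \<cdot>\<^sub>v E p (p + 1) \<and>
      row A (p + 1) =
        (mu - 1) \<cdot>\<^sub>v E p 0 + q_of p z \<cdot>\<^sub>v E p p - E p (p + 1) + E p (nat (r_of p z)))"
proof -
  let ?g = "generator p d m0 n" and ?f = "(v - 1) * n - m0"
  \<comment> \<open>Both factors of \<open>W\<close> are nonempty, which gives the two lower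
    bounds.\<close>
  have zw: "z \<ge> 1" "w \<ge> 1" "w \<le> v - 1"
    using assms(10,19) by auto
  \<comment> \<open>Division with remainder gives \<open>u - z = q' p + r' = 0 p + 1\<close>. Hence
    \<open>g_of\<close> at \<open>u - z\<close> is \<open>m_1 = m0 + d\<close>.\<close>
  have uz: "u - z = 1"
    using q_of_r_of_iff[OF assms(1), of "u - z" q' r'] assms(17,18,20,22) by auto
  \<comment> \<open>Already \<open>lam + mu \<ge> 2\<close>, since \<open>mu > 0\<close>. This makes
    the entry \<open>nu - 2\<close> nonnegative.\<close>
  have nu: "nu \<ge> 2"
    using assms(11,16,21) by (simp split: if_splits)
  have g1: "g_of p d m0 1 = m0 + d"
    by (simp add: g_of_def q_of_def r_of_def m_seq_def)
  have rel: "nu * m0 = m0 + d + (v - w) * n"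
    using assms(15) uz g1 by simp
  have qz: "q_of p z \<ge> 0"
    using zw assms(1) by (simp add: q_of_def pos_imp_zdiv_nonneg_iff)
  \<comment> \<open>The upper bound keeps \<open>E p (nat (r_of p z))\<close> away from column
    \<open>p + 1\<close>, so the diagonal entry of the last row stays -1.\<close>
  have rz: "r_of p z \<ge> 1" "r_of p z \<le> int p"
    using q_of_r_of_iff[OF assms(1), of z "q_of p z" "r_of p z"] by auto
  \<comment> \<open>Remainders range over \<open>[1, p]\<close>, so 0 has quotient -1 and remainder
    \<open>p\<close>, and the two terms cancel. For \<open>q' = 0\<close> the index
    \<open>(q' - 1) p + p\<close> in \<open>alpha\<close> is exactly 0.\<close>
  have g0: "g_of p d m0 0 = 0"
  proof -
    have "q_of p 0 = -1" "r_of p 0 = int p"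
      using q_of_r_of_iff[OF assms(1), of 0 "-1" "int p"] assms(1) by auto
    then show ?thesis
      by (simp add: g_of_def)
  qed
  have alpha: "alpha p d m0 n v q' (int p) = ?f"
    using assms(22) by (simp add: alpha_def g0)
  define R where "R = (\<lambda>i. if i = 0 then - E p 0 + (v - 1) \<cdot>\<^sub>v E p (p + 1)
      else if i \<le> p then (nu - 2) \<cdot>\<^sub>v E p 0 + E p (i - 1) - E p i + (w - 1) \<cdot>\<^sub>v E p (p + 1)
      else (mu - 1) \<cdot>\<^sub>v E p 0 + q_of p z \<cdot>\<^sub>v E p p - E p (p + 1) + E p (nat (r_of p z)))"
  define A where "A = mat\<^sub>r (p + 2) (p + 2) R"
  have dim: "R i \<in> carrier_vec (p + 2)" for i
    by (simp add: R_def)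
  have row: "row A i = R i" if "i < p + 2" for i
    unfolding A_def using that dim by simp
  have A: "A \<in> carrier_mat (p + 2) (p + 2)"
    by (simp add: A_def)
  have entry: "A $$ (i, j) = R i $ j" if "i < p + 2" "j < p + 2" for i j
    using row[OF that(1)] that A by (metis carrier_matD index_row(1))
  have diag: "A $$ (i, i) = -1" if "i < p + 2" for i
    using that rz assms(1) by (auto simp: entry R_def)
  \<comment> \<open>The coefficients to control are \<open>v - 1\<close>, \<open>nu - 2\<close>,
    \<open>w - 1\<close>, \<open>mu - 1\<close> and \<open>q_of p z\<close>, each nonnegative by the
    bounds above.\<close>
  have off: "A $$ (i, j) \<ge> 0" if "i < p + 2" "j < p + 2" "i \<noteq> j" for i j
    using that rz assms(1,21) nu zw qz by (auto simp: entry R_def)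
  have sum_E: "(\<Sum>j<p + 2. E p k $ j * ?g j) = ?g k" if "k < p + 2" for k
  proof -
    have "(\<Sum>j<p + 2. E p k $ j * ?g j) = (\<Sum>j<p + 2. if j = k then ?g j else 0)"
      by (intro sum.cong) (use that in \<open>auto simp: unit_vec_def\<close>)
    then show ?thesis
      using that by simp
  qed
  have rows: "(\<Sum>j<p + 2. A $$ (i, j) * ?g j) = ?f" if i: "i < p + 2" for i
  proof -
    have "(\<Sum>j<p + 2. A $$ (i, j) * ?g j) = (\<Sum>j<p + 2. R i $ j * ?g j)"
      by (intro sum.cong refl) (simp only: entry i lessThan_iff)
    also consider "i = 0" | "1 \<le> i" "i \<le> p" | "i = p + 1"
      using i by linarith
    then have "(\<Sum>j<p + 2. R i $ j * ?g j) = ?f"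
    proof cases
      case 1
      then have "(\<Sum>j<p + 2. R i $ j * ?g j)
          = (\<Sum>j<p + 2. - (E p 0 $ j * ?g j) + (v - 1) * (E p (p + 1) $ j * ?g j))"
        by (intro sum.cong) (auto simp: R_def algebra_simps)
      also have "\<dots> = - ?g 0 + (v - 1) * ?g (p + 1)"
        using sum_E[of 0] sum_E[of "p + 1"]
        by (simp only: sum.distrib sum_negf sum_distrib_left[symmetric])
      finally show ?thesis
        by (simp add: generator_def m_seq_def)
    next
      case 2
      then have "(\<Sum>j<p + 2. R i $ j * ?g j)
          = (\<Sum>j<p + 2. (nu - 2) * (E p 0 $ j * ?g j) + E p (i - 1) $ j * ?g j
              - E p i $ j * ?g j + (w - 1) * (E p (p + 1) $ j * ?g j))"
        by (intro sum.cong) (simp_all add: R_def algebra_simps)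
      also have "\<dots> = (nu - 2) * ?g 0 + ?g (i - 1) - ?g i + (w - 1) * ?g (p + 1)"
        using 2 sum_E[of 0] sum_E[of "i - 1"] sum_E[of i] sum_E[of "p + 1"]
        by (simp only: sum.distrib sum_subtractf sum_distrib_left[symmetric])
      \<comment> \<open>Neighbouring terms of the sequence satisfy
        \<open>m_(i-1) - m_i = -d\<close>, so the middle rows all have the same value.\<close>
      also have "\<dots> = (nu - 2) * m0 - d + (w - 1) * n"
        using 2 le_diff_conv[of i 1 p] by (simp add: generator_def m_seq_def of_nat_diff algebra_simps)
      \<comment> \<open>Substituting \<open>nu m0 - d = m0 + (v - w) n\<close> cancels
        \<open>w\<close>.\<close>
      also have "\<dots> = ?f"
        using rel by (simp add: algebra_simps)
      finally show ?thesis .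
    next
      case 3
      let ?r = "nat (r_of p z)"
      have "?r \<le> p"
        using rz by simp
      from 3 have "(\<Sum>j<p + 2. R i $ j * ?g j)
          = (\<Sum>j<p + 2. (mu - 1) * (E p 0 $ j * ?g j) + q_of p z * (E p p $ j * ?g j)
              - E p (p + 1) $ j * ?g j + E p ?r $ j * ?g j)"
        by (intro sum.cong) (simp_all add: R_def algebra_simps)
      also have "\<dots> = (mu - 1) * ?g 0 + q_of p z * ?g p - ?g (p + 1) + ?g ?r"
        using \<open>?r \<le> p\<close> sum_E[of 0] sum_E[of p] sum_E[of "p + 1"] sum_E[of ?r]
        by (simp only: sum.distrib sum_subtractf sum_distrib_left[symmetric])
      \<comment> \<open>The entries \<open>q_z\<close> at \<open>m_p\<close> and 1 at the generator
        with index \<open>r_z\<close> spell out the definition of \<open>g_z\<close>; then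
        \<open>mu m0 + g_z = v n\<close> finishes the row.\<close>
      also have "\<dots> = (mu - 1) * m0 + g_of p d m0 z - n"
        using \<open>?r \<le> p\<close> rz by (simp add: generator_def g_of_def m_seq_def)
      also have "\<dots> = ?f"
        using assms(14) by (simp add: algebra_simps)
      finally show ?thesis .
    qed
    finally show ?thesis .
  qed
  have "?f \<notin> H p d m0 n"
    using minimal_multiple_not_in_H[of d m0 n p] assms(2-4,8) by simp
  then have PF: "?f \<in> PF (H p d m0 n)"
    using diag off rows by (rule PF_if_RF_rows)
  then have "RF_matrix p d m0 n ?f A"
    unfolding RF_matrix_def using A diag off rows by blast
  \<comment> \<open>For \<open>j = 1\<close> the summand \<open>E p (j - 1)\<close> is
    \<open>E p 0\<close> and merges with the multiple \<open>nu - 2\<close>.\<close>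
  moreover have "row A 1 = (nu - 1) \<cdot>\<^sub>v E p 0 - E p 1 + (w - 1) \<cdot>\<^sub>v E p (p + 1)"
  proof -
    have "row A 1 = R 1"
      using row assms(1) by simp
    also have "\<dots> = (nu - 1) \<cdot>\<^sub>v E p 0 - E p 1 + (w - 1) \<cdot>\<^sub>v E p (p + 1)"
      using assms(1) by (intro eq_vecI) (auto simp: R_def)
    finally show ?thesis .
  qed
  moreover have "PF1 p d m0 n v q' r' = {?f}"
    using PF alpha assms(20,22) by (auto simp: PF1_def alpha_index_def)
  ultimately show ?thesis
    using assms(1) row by (auto simp: alpha R_def intro!: exI[of _ A])
qed

end
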